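(* Let $G$ and $H$ be finite groups with $\mathrm{os}(G)=\mathrm{os}(H)$. Then the labelled Gruenberg--Kegel graphs of $G$ and $H$ are equal.
   Context: For a finite group $G$ of order $n$, the order sequence $\mathrm{os}(G)$ is the list of orders of all elements of $G$ arranged in non-decreasing order. The Gruenberg--Kegel graph of a finite group $G$ has as vertices the prime divisors of $|G|$, with an edge $\{p,q\}$ (for distinct primes $p,q$) if and only if $G$ contains an element of order $pq$. It is considered as a labelled graph by labelling each vertex by the corresponding prime. *)

theory Defs
  imports
    "HOL-Algebra.Multiplicative_Group"
    "HOL-Library.Multiset"
    "HOL-Computational_Algebra.Primes"
    "Graph_Theory.Pair_Digraph"
begin

definition os :: "('a, 'm) monoid_scheme \<Rightarrow> nat list" where
  "os G = sorted_list_of_multiset (image_mset (group.ord G) (mset_set (carrier G)))"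

text \<open>
  Graphs are symmetric digraphs, so an edge between \<open>p\<close> and \<open>q\<close> is the pair of arcs
  \<open>(p, q)\<close>, \<open>(q, p)\<close>. The vertices are the primes themselves, so every vertex is its own
  label; equality of labelled graphs is therefore equality of vertex and arc sets.
\<close>

definition GK_graph :: "('a, 'm) monoid_scheme \<Rightarrow> nat pair_pre_digraph" where
  "GK_graph G =
    (let V = {p. prime p \<and> p dvd order G} in
     \<lparr> pverts = V,
       parcs = {(p, q). p \<in> V \<and> q \<in> V \<and> p \<noteq> q \<and> (\<exists>x \<in> carrier G. group.ord G x = p * q)} \<rparr>)"

lemma sorted_os: "sorted (os G)"
  by (simp add: os_def)

lemma mset_os: "mset (os G) = image_mset (group.ord G) (mset_set (carrier G))"
  by (simp add: os_def)

lemma pair_graph_GK_graph: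
  assumes "group G" "finite (carrier G)"
  shows "pair_graph (GK_graph G)"
proof -
  interpret group G by fact
  let ?V = "{p. prime p \<and> p dvd order G}"
  have "order G > 0"
    using assms(2) by (simp add: order_gt_0_iff_finite)
  then have fin: "finite ?V"
    by (intro finite_subset[OF _ finite_divisors_nat[of "order G"]]) auto
  have "finite (parcs (GK_graph G))"
    by (rule finite_subset[OF _ finite_cartesian_product[OF fin fin]]) (auto simp: GK_graph_def Let_def)
  with fin show ?thesis
    by unfold_locales
      (auto simp: GK_graph_def Let_def symmetric_def arcs_ends_def arc_to_ends_def mult.commute
        intro!: symI)
qed

end

theory Submission
  imports Defs
begin

text \<open>
  The Gruenberg--Kegel graph is read off from two data: the group order, whose prime divisors are
  the vertices, and the set of element orders, which decides the edges. The order sequence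
  determines both, since it has one entry per group element.
\<close>

lemma length_os: "length (os G) = order G"
proof -
  have "length (os G) = size (mset (os G))"
    by simp
  then show ?thesis
    by (simp add: mset_os order_def)
qed

lemma set_os:
  assumes "finite (carrier G)"
  shows "set (os G) = group.ord G ` carrier G"
proof -
  have "set (os G) = set_mset (mset (os G))"
    by simp
  then show ?thesis
    using assms by (simp add: mset_os)
qed

lemma GK_graph_eqI:
  assumes "order G = order H"
    and "group.ord G ` carrier G = group.ord H ` carrier H"
  shows "GK_graph G = GK_graph H"
proof -
  have "(\<exists>x \<in> carrier G. group.ord G x = k) \<longleftrightarrow> (\<exists>x \<in> carrier H. group.ord H x = k)" for k
    using assms(2) by (metis image_iff)
  then show ?thesis
    using assms(1) by (simp add: GK_graph_def)
qed

theorem proposition7p2: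
  fixes G :: "('a, 'm) monoid_scheme" and H :: "('b, 'n) monoid_scheme"
  assumes "group G" and "finite (carrier G)"
    and "group H" and "finite (carrier H)"
    and "os G = os H"
  shows "GK_graph G = GK_graph H"
proof (rule GK_graph_eqI)
  show "order G = order H"
    using assms(5) by (metis length_os)
  show "group.ord G ` carrier G = group.ord H ` carrier H"
    using assms(2,4,5) by (metis set_os)
qed

end
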